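(* For every infinite cardinal $\kappa$: (i) if $\kappa<\mathfrak b$, then $\mathsf P_\kappa$ holds; (ii) if $\kappa\geqslant 2^{\aleph_0}$, then $\mathsf P_\kappa$ fails.
   Context: Banach spaces are over $\mathbb K\in\{\mathbb R,\mathbb C\}$. For a Banach space $E$, $S(E^* )$ denotes the unit sphere of the dual $E^*$. A sequence $(y_n^* )\subset S(E^* )$ is called normal if it converges to zero in the weak$^*$ topology of $E^*$. A sequence $(y_n^* )\subset S(E^* )$ is called strongly normal if the linear subspace $\{x\in E:\sum_{n=1}^\infty |y_n^*(x)|<\infty\}$ is norm dense in $E$. For an infinite cardinal $\kappa$, $\ell_1(\kappa)$ is the Banach space of absolutely summable families of scalars indexed by $\kappa$ with norm $\|x\|=\sum_{\alpha\in\kappa}|x(\alpha)|$, and $\mathsf P_\kappa$ denotes the assertion: every normal sequence in $\ell_1(\kappa)^*$ has a strongly normal subsequence. For $f,g\in\mathbb N^{\mathbb N}$ write $f\leqslant^* g$ if $f(k)\leqslant g(k)$ for all sufficiently large $k$. The bounding number $\mathfrak b$ is the least cardinality of a family $\mathcal F\subseteq\mathbb N^{\mathbb N}$ for which there is no $g\in\mathbb N^{\mathbb N}$ with $f\leqslant^* g$ for all $f\in\mathcal F$. *)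

theory Defs
  imports "HOL-Analysis.Analysis"
begin

unbundle cardinal_syntax

no_notation Infinite_Set_Sum.abs_summable_on (infix \<open>abs'_summable'_on\<close> 50)

text \<open>
  The class of type \<open>'e\<close> only provides the underlying real Banach space; the scalar multiplication
  by \<open>'k\<close> (to be instantiated with \<open>real\<close> or \<open>complex\<close>) is a separate parameter that
  extends \<open>scaleR\<close>.
\<close>

locale banach_over = vector_space scale
  for scale :: "'k::{real_normed_field, banach} \<Rightarrow> 'e::banach \<Rightarrow> 'e" +
  assumes scale_of_real: "scale (of_real r) x = r *\<^sub>R x"
    and norm_scale: "norm (scale c x) = norm c * norm x"
begin

definition dual :: "('e \<Rightarrow> 'k) set" where
  "dual = {f. bounded_linear f \<and> (\<forall>c x. f (scale c x) = c * f x)}"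

definition dual_sphere :: "('e \<Rightarrow> 'k) set" where
  "dual_sphere = {f \<in> dual. onorm f = 1}"

text \<open>The weak-star topology is the topology of pointwise convergence on the dual.\<close>

definition weak_star :: "('e \<Rightarrow> 'k) topology" where
  "weak_star = subtopology (product_topology (\<lambda>_. euclidean) UNIV) dual"

definition normal_seq :: "(nat \<Rightarrow> 'e \<Rightarrow> 'k) \<Rightarrow> bool" where
  "normal_seq y \<longleftrightarrow> range y \<subseteq> dual_sphere \<and> limitin weak_star y (\<lambda>_. 0) sequentially"

definition strongly_normal_seq :: "(nat \<Rightarrow> 'e \<Rightarrow> 'k) \<Rightarrow> bool" where
  "strongly_normal_seq y \<longleftrightarrow>
     range y \<subseteq> dual_sphere \<and> closure {x. summable (\<lambda>n. norm (y n x))} = UNIV"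

lemma normal_seq_iff:
  "normal_seq y \<longleftrightarrow> range y \<subseteq> dual_sphere \<and> (\<forall>x. (\<lambda>n. y n x) \<longlonglongrightarrow> 0)"
proof -
  have "(\<lambda>_. 0) \<in> dual"
    by (simp add: dual_def)
  then show ?thesis
    by (auto simp: normal_seq_def weak_star_def limitin_subtopology limitin_componentwise
        dual_sphere_def image_subset_iff)
qed

end

text \<open>
  The families are indexed by a type \<open>'i\<close>, so that \<open>('i, 'k) ell1\<close> is
  \<open>\<ell>\<^sub>1(\<kappa>)\<close> over \<open>'k\<close> for the cardinal \<open>\<kappa> = |UNIV :: 'i set|\<close>.
\<close>

typedef (overloaded) ('i, 'k) ell1 = "{x :: 'i \<Rightarrow> 'k::real_normed_field. x abs_summable_on UNIV}"
  morphisms coord Abs_ell1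
  by (rule exI[of _ "\<lambda>_. 0"]) simp

setup_lifting type_definition_ell1

lemma abs_summable_coord: "coord x abs_summable_on UNIV"
  using coord[of x] by simp

lemma abs_summable_on_plus:
  fixes f g :: "'i \<Rightarrow> 'k::real_normed_vector"
  assumes "f abs_summable_on A" "g abs_summable_on A"
  shows "(\<lambda>i. f i + g i) abs_summable_on A"
  by (rule Infinite_Sum.abs_summable_on_comparison_test'[OF summable_on_add[OF assms]])
    (rule norm_triangle_ineq)

instantiation ell1 :: (type, real_normed_field) real_normed_vector
begin

lift_definition zero_ell1 :: "('a, 'b) ell1" is "\<lambda>_. 0"
  by simp

lift_definition plus_ell1 :: "('a, 'b) ell1 \<Rightarrow> ('a, 'b) ell1 \<Rightarrow> ('a, 'b) ell1"
  is "\<lambda>x y i. x i + y i"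
  by (rule abs_summable_on_plus)

lift_definition uminus_ell1 :: "('a, 'b) ell1 \<Rightarrow> ('a, 'b) ell1" is "\<lambda>x i. - x i"
  by simp

lift_definition minus_ell1 :: "('a, 'b) ell1 \<Rightarrow> ('a, 'b) ell1 \<Rightarrow> ('a, 'b) ell1"
  is "\<lambda>x y i. x i - y i"
  subgoal for x y
    using abs_summable_on_plus[of x UNIV "\<lambda>i. - y i"] by simp
  done

lift_definition scaleR_ell1 :: "real \<Rightarrow> ('a, 'b) ell1 \<Rightarrow> ('a, 'b) ell1" is "\<lambda>r x i. r *\<^sub>R x i"
  by (simp add: summable_on_cmult_right)

definition norm_ell1 :: "('a, 'b) ell1 \<Rightarrow> real" where
  "norm_ell1 x = (\<Sum>\<^sub>\<infinity>i. norm (coord x i))"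

definition dist_ell1 :: "('a, 'b) ell1 \<Rightarrow> ('a, 'b) ell1 \<Rightarrow> real" where
  "dist_ell1 x y = norm (x - y)"

definition sgn_ell1 :: "('a, 'b) ell1 \<Rightarrow> ('a, 'b) ell1" where
  "sgn_ell1 x = inverse (norm x) *\<^sub>R x"

definition uniformity_ell1 :: "(('a, 'b) ell1 \<times> ('a, 'b) ell1) filter" where
  "uniformity_ell1 = (INF e\<in>{0 <..}. principal {(x, y). dist x y < e})"

definition open_ell1 :: "('a, 'b) ell1 set \<Rightarrow> bool" where
  "open_ell1 U \<longleftrightarrow> (\<forall>x\<in>U. \<forall>\<^sub>F (x', y) in uniformity. x' = x \<longrightarrow> y \<in> U)"

instance
proof
  fix x y z :: "('a, 'b) ell1" and r s :: real
  show "x + y + z = x + (y + z)" by transfer (simp add: add.assoc)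
  show "x + y = y + x" by transfer (simp add: add.commute)
  show "0 + x = x" by transfer simp
  show "- x + x = 0" by transfer simp
  show "x - y = x + - y" by transfer simp
  show "r *\<^sub>R (x + y) = r *\<^sub>R x + r *\<^sub>R y" by transfer (simp add: scaleR_add_right)
  show "(r + s) *\<^sub>R x = r *\<^sub>R x + s *\<^sub>R x" by transfer (simp add: scaleR_add_left)
  show "r *\<^sub>R s *\<^sub>R x = (r * s) *\<^sub>R x" by transfer simp
  show "1 *\<^sub>R x = x" by transfer simp
  show "dist x y = norm (x - y)" by (rule dist_ell1_def)
  show "sgn x = inverse (norm x) *\<^sub>R x" by (rule sgn_ell1_def)
  show "uniformity = (INF e\<in>{0 <..}. principal {(x :: ('a, 'b) ell1, y). dist x y < e})"
    by (rule uniformity_ell1_def)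
  show "open U \<longleftrightarrow> (\<forall>x\<in>U. \<forall>\<^sub>F (x', y) in uniformity. x' = x \<longrightarrow> y \<in> U)"
    for U :: "('a, 'b) ell1 set"
    by (rule open_ell1_def)
  have "norm x = 0 \<longleftrightarrow> (\<forall>i. coord x i = 0)"
  proof
    assume "norm x = 0"
    then have "norm (coord x i) = 0" for i
      using nonneg_infsum_le_0D[OF _ abs_summable_coord[of x], of i] by (simp add: norm_ell1_def)
    then show "\<forall>i. coord x i = 0" by simp
  qed (simp add: norm_ell1_def)
  then show "norm x = 0 \<longleftrightarrow> x = 0"
    by (simp add: coord_inject[symmetric] zero_ell1.rep_eq fun_eq_iff)
  have "norm (x + y) \<le> (\<Sum>\<^sub>\<infinity>i. norm (coord x i) + norm (coord y i))"
    unfolding norm_ell1_def plus_ell1.rep_eq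
    by (intro infsum_mono abs_summable_on_plus summable_on_add abs_summable_coord norm_triangle_ineq)
  also have "\<dots> = norm x + norm y"
    unfolding norm_ell1_def by (intro infsum_add abs_summable_coord)
  finally show "norm (x + y) \<le> norm x + norm y" .
  show "norm (r *\<^sub>R x) = \<bar>r\<bar> * norm x"
    unfolding norm_ell1_def scaleR_ell1.rep_eq
    by (simp add: infsum_cmult_right abs_summable_coord)
qed

end

lemma sum_coord_le_norm: "finite F \<Longrightarrow> (\<Sum>i\<in>F. norm (coord x i)) \<le> norm x"
  unfolding norm_ell1_def by (intro finite_sum_le_infsum abs_summable_coord) auto

lemma norm_coord_le: "norm (coord x i) \<le> norm x"
  using sum_coord_le_norm[of "{i}" x] by simp

instance ell1 :: (type, "{real_normed_field, banach}") banach
proof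
  fix X :: "nat \<Rightarrow> ('a, 'b) ell1"
  assume X: "Cauchy X"
  have "Cauchy (\<lambda>n. coord (X n) i)" for i
  proof (rule metric_CauchyI)
    fix e :: real assume "e > 0"
    then obtain N where N: "\<forall>m\<ge>N. \<forall>n\<ge>N. dist (X m) (X n) < e"
      using metric_CauchyD[OF X] by blast
    have "dist (coord (X m) i) (coord (X n) i) < e" if "m \<ge> N" "n \<ge> N" for m n
      using N that norm_coord_le[of "X m - X n" i]
      by (force simp: dist_norm minus_ell1.rep_eq)
    then show "\<exists>N. \<forall>m\<ge>N. \<forall>n\<ge>N. dist (coord (X m) i) (coord (X n) i) < e" by blast
  qed
  then have "\<exists>l. (\<lambda>n. coord (X n) i) \<longlonglongrightarrow> l" for i
    using Cauchy_convergent_iff convergent_def by blast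
  then obtain l where l: "\<And>i. (\<lambda>n. coord (X n) i) \<longlonglongrightarrow> l i" by metis
  have tail: "\<exists>N. \<forall>n\<ge>N. \<forall>F. finite F \<longrightarrow> (\<Sum>i\<in>F. norm (coord (X n) i - l i)) \<le> e"
    if "e > 0" for e
  proof -
    obtain N where N: "\<forall>m\<ge>N. \<forall>n\<ge>N. dist (X m) (X n) < e"
      using metric_CauchyD[OF X \<open>e > 0\<close>] by blast
    have "(\<Sum>i\<in>F. norm (coord (X n) i - l i)) \<le> e" if "n \<ge> N" "finite F" for n F
    proof (rule tendsto_upperbound)
      show "(\<lambda>m. \<Sum>i\<in>F. norm (coord (X n) i - coord (X m) i))
              \<longlonglongrightarrow> (\<Sum>i\<in>F. norm (coord (X n) i - l i))"
        by (intro tendsto_intros l)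
      have "(\<Sum>i\<in>F. norm (coord (X n) i - coord (X m) i)) \<le> e" if "m \<ge> N" for m
      proof -
        have "dist (X n) (X m) < e" using N that \<open>n \<ge> N\<close> by blast
        then show ?thesis
          using sum_coord_le_norm[OF \<open>finite F\<close>, of "X n - X m"]
          by (simp add: dist_norm minus_ell1.rep_eq)
      qed
      then show "\<forall>\<^sub>F m in sequentially. (\<Sum>i\<in>F. norm (coord (X n) i - coord (X m) i)) \<le> e"
        by (auto simp: eventually_sequentially)
    qed simp
    then show ?thesis by blast
  qed
  have diff: "(\<lambda>i. coord (X n) i - l i) abs_summable_on UNIV"
    if "\<forall>F. finite F \<longrightarrow> (\<Sum>i\<in>F. norm (coord (X n) i - l i)) \<le> e" for n e
    unfolding abs_summable_iff_bdd_above using that by (auto intro!: bdd_aboveI2[of _ _ e])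
  obtain N where "\<forall>F. finite F \<longrightarrow> (\<Sum>i\<in>F. norm (coord (X N) i - l i)) \<le> 1"
    using tail[of 1] by auto
  from diff[OF this] have "(\<lambda>i. l i - coord (X N) i) abs_summable_on UNIV"
    by (simp add: norm_minus_commute)
  from abs_summable_on_plus[OF this abs_summable_coord[of "X N"]]
  have "l abs_summable_on UNIV" by simp
  then have L: "coord (Abs_ell1 l) = l" by (simp add: Abs_ell1_inverse)
  have "X \<longlonglongrightarrow> Abs_ell1 l"
  proof (rule metric_LIMSEQ_I)
    fix e :: real assume "e > 0"
    then obtain N
      where N: "\<forall>n\<ge>N. \<forall>F. finite F \<longrightarrow> (\<Sum>i\<in>F. norm (coord (X n) i - l i)) \<le> e / 2"
      using tail[of "e / 2"] by auto
    have "dist (X n) (Abs_ell1 l) < e" if "n \<ge> N" for n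
    proof -
      have n: "\<forall>F. finite F \<longrightarrow> (\<Sum>i\<in>F. norm (coord (X n) i - l i)) \<le> e / 2"
        using N that by blast
      have "(\<Sum>\<^sub>\<infinity>i. norm (coord (X n) i - l i)) \<le> e / 2"
        by (rule infsum_le_finite_sums[OF diff[OF n]]) (use n in blast)
      then show ?thesis
        using \<open>e > 0\<close> by (simp add: dist_norm norm_ell1_def minus_ell1.rep_eq L)
    qed
    then show "\<exists>N. \<forall>n\<ge>N. dist (X n) (Abs_ell1 l) < e" by blast
  qed
  then show "convergent X" by (auto simp: convergent_def)
qed

lift_definition scale_ell1 ::
  "'k::real_normed_field \<Rightarrow> ('i, 'k) ell1 \<Rightarrow> ('i, 'k) ell1" is "\<lambda>c x i. c * x i"
  by (simp add: norm_mult summable_on_cmult_right)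

interpretation ell1: banach_over
  "scale_ell1 :: 'k::{real_normed_field, banach} \<Rightarrow> ('i, 'k) ell1 \<Rightarrow> ('i, 'k) ell1"
proof
  fix a b :: 'k and x y :: "('i, 'k) ell1" and r :: real
  show "scale_ell1 a (x + y) = scale_ell1 a x + scale_ell1 a y"
    by transfer (simp add: distrib_left)
  show "scale_ell1 (a + b) x = scale_ell1 a x + scale_ell1 b x"
    by transfer (simp add: distrib_right)
  show "scale_ell1 a (scale_ell1 b x) = scale_ell1 (a * b) x"
    by transfer (simp add: mult.assoc)
  show "scale_ell1 1 x = x"
    by transfer simp
  show "scale_ell1 (of_real r) x = r *\<^sub>R x"
    by transfer (simp add: scaleR_conv_of_real)
  show "norm (scale_ell1 a x) = norm a * norm x"
    by (simp add: norm_ell1_def scale_ell1.rep_eq norm_mult infsum_cmult_right abs_summable_coord)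
qed

text \<open>
  \<open>property_P TYPE('i) TYPE('k)\<close> is \<open>P\<^sub>\<kappa>\<close> for \<open>\<kappa> = |UNIV :: 'i set|\<close> and scalar field \<open>'k\<close>.
\<close>

definition property_P :: "'i itself \<Rightarrow> 'k::{real_normed_field, banach} itself \<Rightarrow> bool" where
  "property_P _ _ \<longleftrightarrow>
     (\<forall>y :: nat \<Rightarrow> ('i, 'k) ell1 \<Rightarrow> 'k. ell1.normal_seq y \<longrightarrow>
        (\<exists>r. strict_mono r \<and> ell1.strongly_normal_seq (y \<circ> r)))"

definition le_star :: "(nat \<Rightarrow> nat) \<Rightarrow> (nat \<Rightarrow> nat) \<Rightarrow> bool"  (infix \<open>\<le>\<^sup>*\<close> 50) where
  "f \<le>\<^sup>* g \<longleftrightarrow> (\<forall>\<^sub>F k in sequentially. f k \<le> g k)"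

definition unbounded_family :: "(nat \<Rightarrow> nat) set \<Rightarrow> bool" where
  "unbounded_family F \<longleftrightarrow> (\<nexists>g. \<forall>f\<in>F. f \<le>\<^sup>* g)"

definition bounding_number :: "(nat \<Rightarrow> nat) rel" where
  "bounding_number =
     |SOME F. unbounded_family F \<and> (\<forall>G. unbounded_family G \<longrightarrow> |F| \<le>o |G| )|"

lemma unbounded_family_UNIV: "unbounded_family UNIV"
  unfolding unbounded_family_def le_star_def
proof
  assume "\<exists>g :: nat \<Rightarrow> nat. \<forall>f\<in>UNIV. \<forall>\<^sub>F k in sequentially. f k \<le> g k"
  then obtain g :: "nat \<Rightarrow> nat" where "\<forall>\<^sub>F k in sequentially. Suc (g k) \<le> g k"
    by (metis UNIV_I)
  then show False by simp
qed

text \<open>The choice in \<open>bounding_number\<close> is from a nonempty set.\<close>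

lemma bounding_number_minimal:
  "\<exists>F. unbounded_family F \<and> bounding_number = |F| \<and> (\<forall>G. unbounded_family G \<longrightarrow> |F| \<le>o |G| )"
proof -
  have "\<exists>F. unbounded_family F \<and> (\<forall>G. unbounded_family G \<longrightarrow> |F| \<le>o |G| )"
    using exists_minim_Card_order[of "card_of ` Collect unbounded_family"] unbounded_family_UNIV
    by (auto simp: card_of_Card_order)
  from someI_ex[OF this] show ?thesis
    unfolding bounding_number_def by blast
qed

end

theory Submission
  imports Defs
begin

text \<open>
  Below \<open>\<bb>\<close>, a normal sequence \<open>y\<close> tends to zero at every unit vector, and the speeds of
  convergence at the \<open>\<kappa>\<close> unit vectors are functions \<open>f\<^sub>i\<close> from naturals to naturals with
  \<open>|y\<^sub>n(e\<^sub>i)| < 2\<^sup>-\<^sup>k\<close> for \<open>n \<ge> f\<^sub>i(k)\<close>.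
  As \<open>\<kappa> < \<bb>\<close>, a single function eventually dominates all of them. A subsequence that grows at least as
  fast as this function is absolutely summable at every unit vector, hence on their linear span,
  which is dense (\<open>common_summable_subsequence\<close>, \<open>dense_subspaceI\<close>).

  From the continuum on, \<open>\<ell>\<^sub>1(\<kappa>)\<close> has enough coordinates to carry one real sequence for every set
  \<open>R\<close> of naturals: the sequence \<open>rank_weight R\<close>, which vanishes off \<open>R\<close> and takes the values
  \<open>1, 1/\<surd>2, 1/\<surd>3, \<dots>\<close> along \<open>R\<close>. Let \<open>y\<^sub>n\<close> be the functional whose value at the unit vector of \<open>R\<close>
  is \<open>rank_weight R n\<close>. Two facts about it conflict with strong normality of any subsequence \<open>r\<close>.
  \<^item> Every one of these sequences has sums at most \<open>2 \<surd>|A|\<close> over finite sets \<open>A\<close>, and such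
    bounds survive absolutely convergent combinations, so \<open>\<Sum>n\<in>A. |y\<^sub>n(x)| \<le> 2 \<parallel>x\<parallel> \<surd>|A|\<close> for all
    vectors \<open>x\<close>. This forces \<open>y\<^sub>n(x)\<close> to tend to zero, and \<open>y\<close> is normal: the norms are one because
    of the sequences for singletons \<open>R\<close>.
  \<^item> At the unit vector of \<open>R = range r\<close>, the first \<open>N\<close> members of the subsequence sum up to at least
    \<open>\<surd>N\<close>.
  Hence at any \<open>x\<close> within distance \<open>1/4\<close> of that unit vector they still sum up to at least
  \<open>\<surd>N / 2\<close>, which is unbounded: the subspace of absolute summability misses a ball. In other words,
  \<open>\<ell>\<^sub>1(\<kappa>)\<close> is mapped into the weak \<open>\<ell>\<^sub>2\<close> space, where \<open>(1/\<surd>n)\<^sub>n\<close>, spread out along any infinite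
  set, is not a limit of absolutely summable sequences.
\<close>

section \<open>Truncations in the space of summable families\<close>

lift_definition unit_vec :: "'i \<Rightarrow> ('i, 'k::real_normed_field) ell1"
  is "\<lambda>i j. if j = i then 1 else 0"
  by (rule summable_on_cong_neutral[THEN iffD1, OF _ _ _ summable_on_finite[of "{_}"]]) auto

lift_definition truncate ::
  "'i set \<Rightarrow> ('i, 'k) ell1 \<Rightarrow> ('i, 'k::real_normed_field) ell1"
  is "\<lambda>F x i. if i \<in> F then x i else 0"
  by (erule Infinite_Sum.abs_summable_on_comparison_test') simp

lemma norm_unit_vec [simp]: "norm (unit_vec i :: ('i, 'k::real_normed_field) ell1) = 1"
proof -
  have "norm (unit_vec i :: ('i, 'k) ell1) = (\<Sum>\<^sub>\<infinity>j\<in>{i}. 1 :: real)"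
    unfolding norm_ell1_def unit_vec.rep_eq by (rule infsum_cong_neutral) auto
  then show ?thesis by simp
qed

lemma norm_truncate: "norm (truncate F x) = (\<Sum>\<^sub>\<infinity>i\<in>F. norm (coord x i))"
  unfolding norm_ell1_def truncate.rep_eq by (rule infsum_cong_neutral) auto

lemma truncate_insert:
  "i \<notin> F \<Longrightarrow> truncate (insert i F) x = truncate F x + scale_ell1 (coord x i) (unit_vec i)"
  by transfer (auto simp: fun_eq_iff)

lemma truncate_in_subspace:
  assumes "finite F" and D: "ell1.subspace D" and "\<And>i. unit_vec i \<in> D"
  shows "truncate F x \<in> D"
  using assms(1)
proof (induction F)
  case empty
  have "truncate {} x = 0" by transfer simp
  then show ?case using ell1.subspace_0[OF D] by simp
next
  case (insert i F)
  then show ?case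
    using assms by (simp add: truncate_insert ell1.subspace_add ell1.subspace_scale)
qed

lemma truncate_approximates:
  assumes "e > 0"
  shows "\<exists>F. finite F \<and> dist (truncate F x) x < e"
proof -
  have "((\<lambda>i. norm (coord x i)) has_sum norm x) UNIV"
    unfolding norm_ell1_def by (rule has_sum_infsum[OF abs_summable_coord])
  then have "\<forall>\<^sub>F F in finite_subsets_at_top UNIV. dist (\<Sum>i\<in>F. norm (coord x i)) (norm x) < e"
    unfolding has_sum_def using assms by (rule tendstoD)
  then obtain F where F: "finite F" "dist (\<Sum>i\<in>F. norm (coord x i)) (norm x) < e"
    unfolding eventually_finite_subsets_at_top by blast
  have "norm (truncate (- F) x) = (\<Sum>\<^sub>\<infinity>i. norm (coord x i)) - (\<Sum>\<^sub>\<infinity>i\<in>F. norm (coord x i))"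
    unfolding norm_truncate Compl_eq_Diff_UNIV
    by (rule infsum_Diff) (use F abs_summable_coord in auto)
  moreover have "x - truncate F x = truncate (- F) x"
    by transfer (auto simp: fun_eq_iff)
  ultimately have "dist x (truncate F x) < e"
    using F by (simp add: dist_norm norm_ell1_def)
  then show ?thesis using F by (auto simp: dist_commute)
qed

text \<open>
  This is how density of the subspace in the definition of strong normality gets checked: the
  truncations to finite sets lie in the subspace and approximate every vector.
\<close>

lemma dense_subspaceI:
  fixes D :: "('i, 'k::{real_normed_field, banach}) ell1 set"
  assumes "ell1.subspace D" "\<And>i. unit_vec i \<in> D"
  shows "closure D = UNIV"
proof -
  have "\<exists>y\<in>D. dist y x < e" if "e > 0" for x e
    using truncate_approximates[OF that] truncate_in_subspace[OF _ assms] by blast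
  then show ?thesis by (auto simp: closure_approachable)
qed

section \<open>Below the bounding number\<close>

text \<open>
  The family may be indexed with repetitions: its range is no larger than the index type, so it is
  smaller than a smallest unbounded family.
\<close>

lemma bounded_family_if_card_less_bounding_number:
  assumes "|UNIV :: 'i set| <o bounding_number"
  shows "\<exists>g. \<forall>i::'i. f i \<le>\<^sup>* g"
proof -
  obtain F where F: "bounding_number = |F|" "\<And>G. unbounded_family G \<Longrightarrow> |F| \<le>o |G|"
    using bounding_number_minimal by blast
  have "|range f| <o |F|"
    using ordLeq_ordLess_trans[OF card_of_image assms] F(1) by simp
  then have "\<not> unbounded_family (range f)"
    using F(2) not_ordLess_ordLeq by blast
  then show ?thesis by (auto simp: unbounded_family_def)
qed

lemma strict_mono_above: "\<exists>r :: nat \<Rightarrow> nat. strict_mono r \<and> (\<forall>k. g k \<le> r k)"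
proof (intro exI conjI allI)
  let ?r = "\<lambda>k. \<Sum>j\<le>k. Suc (g j)"
  show "strict_mono ?r" by (simp add: strict_mono_Suc_iff)
  show "g k \<le> ?r k" for k
    by (rule order_trans[OF _ member_le_sum[of k]]) auto
qed

text \<open>
  The bound \<open>2\<^sup>-\<^sup>k\<close> at the \<open>k\<close>-th member of the subsequence can only be had from some
  \<open>k\<close> on that depends on \<open>i\<close>; eventual domination gives exactly that, and it is enough for
  summability.
\<close>

lemma common_summable_subsequence:
  fixes a :: "'i \<Rightarrow> nat \<Rightarrow> 'k::real_normed_vector"
  assumes "|UNIV :: 'i set| <o bounding_number" and null: "\<And>i. a i \<longlonglongrightarrow> 0"
  shows "\<exists>r. strict_mono r \<and> (\<forall>i. summable (\<lambda>k. norm (a i (r k))))"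
proof -
  have "\<exists>N. \<forall>n\<ge>N. norm (a i n) < (1/2) ^ k" for i k
    using LIMSEQ_D[OF null[of i], of "(1/2) ^ k"] by auto
  then obtain f where f: "\<And>i k n. n \<ge> f i k \<Longrightarrow> norm (a i n) < (1/2) ^ k"
    by metis
  obtain g where g: "\<And>i. f i \<le>\<^sup>* g"
    using bounded_family_if_card_less_bounding_number[OF assms(1)] by blast
  obtain r where r: "strict_mono r" "\<And>k. g k \<le> r k"
    using strict_mono_above by blast
  have "summable (\<lambda>k. norm (a i (r k)))" for i
  proof (rule summable_comparison_test_ev)
    show "summable (\<lambda>k. (1/2::real) ^ k)" by (simp add: summable_geometric)
    show "\<forall>\<^sub>F k in sequentially. norm (norm (a i (r k))) \<le> (1/2) ^ k"
      using g[of i] unfolding le_star_def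
    proof eventually_elim
      case (elim k)
      then show ?case using f[of i k "r k"] r(2)[of k] by auto
    qed
  qed
  then show ?thesis using r(1) by blast
qed

lemma subspace_absolutely_summable:
  fixes z :: "nat \<Rightarrow> ('i, 'k::{real_normed_field, banach}) ell1 \<Rightarrow> 'k"
  assumes "range z \<subseteq> ell1.dual"
  shows "ell1.subspace {x. summable (\<lambda>n. norm (z n x))}"
proof (rule ell1.subspaceI)
  have lin: "bounded_linear (z n)" "z n (scale_ell1 c x) = c * z n x" for n c x
    using assms by (auto simp: ell1.dual_def)
  then have add: "z n (x + y) = z n x + z n y" "z n 0 = 0" for n x y
    by (auto simp: linear_simps bounded_linear.linear linear_0)
  show "0 \<in> {x. summable (\<lambda>n. norm (z n x))}"
    by (simp add: add)
  fix x assume x: "x \<in> {x. summable (\<lambda>n. norm (z n x))}"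
  show "scale_ell1 c x \<in> {x. summable (\<lambda>n. norm (z n x))}" for c
    using x by (simp add: lin norm_mult summable_mult)
  fix y assume "y \<in> {x. summable (\<lambda>n. norm (z n x))}"
  with x have "summable (\<lambda>n. norm (z n x) + norm (z n y))"
    by (simp add: summable_add)
  then have "summable (\<lambda>n. norm (z n (x + y)))"
    by (rule summable_comparison_test') (simp add: add norm_triangle_ineq)
  then show "x + y \<in> {x. summable (\<lambda>n. norm (z n x))}" by simp
qed

proposition property_P_below_bounding_number:
  assumes "|UNIV :: 'i set| <o bounding_number"
  shows "property_P TYPE('i) TYPE('k::{real_normed_field, banach})"
  unfolding property_P_def
proof (intro allI impI)
  fix y :: "nat \<Rightarrow> ('i, 'k) ell1 \<Rightarrow> 'k"
  assume "ell1.normal_seq y"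
  then have y: "range y \<subseteq> ell1.dual_sphere" "\<And>x. (\<lambda>n. y n x) \<longlonglongrightarrow> 0"
    by (auto simp: ell1.normal_seq_iff)
  obtain r where r: "strict_mono r" "\<And>i. summable (\<lambda>k. norm (y (r k) (unit_vec i)))"
    using common_summable_subsequence[OF assms, of "\<lambda>i n. y n (unit_vec i)", OF y(2)] by blast
  have sub: "range (y \<circ> r) \<subseteq> ell1.dual_sphere"
    using y(1) by auto
  then have "range (y \<circ> r) \<subseteq> ell1.dual"
    by (auto simp: ell1.dual_sphere_def)
  from subspace_absolutely_summable[OF this] have "ell1.strongly_normal_seq (y \<circ> r)"
    unfolding ell1.strongly_normal_seq_def using sub r(2)
    by (auto intro!: dense_subspaceI[THEN equalityD2, THEN subsetD])
  then show "\<exists>r. strict_mono r \<and> ell1.strongly_normal_seq (y \<circ> r)"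
    using r(1) by blast
qed

section \<open>Bounded families as functionals\<close>

text \<open>
  Real families \<open>w\<close> suffice for both scalar fields, as the counterexample has real coefficients.
\<close>

definition pairing :: "('i \<Rightarrow> real) \<Rightarrow> ('i, 'k::{real_normed_field, banach}) ell1 \<Rightarrow> 'k" where
  "pairing w x = (\<Sum>\<^sub>\<infinity>i. of_real (w i) * coord x i)"

lemma abs_summable_pairing:
  assumes "\<And>i. \<bar>w i\<bar> \<le> B"
  shows "(\<lambda>i. of_real (w i) * coord x i) abs_summable_on UNIV"
proof (rule Infinite_Sum.abs_summable_on_comparison_test')
  show "(\<lambda>i. B * norm (coord x i)) summable_on UNIV"
    by (intro summable_on_cmult_right abs_summable_coord)
  show "norm (of_real (w i) * coord x i) \<le> B * norm (coord x i)" for i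
    using assms by (simp add: norm_mult mult_right_mono)
qed

lemma has_sum_sum:
  fixes f :: "'n \<Rightarrow> 'i \<Rightarrow> 'b::topological_comm_monoid_add"
  assumes "finite A" "\<And>n. n \<in> A \<Longrightarrow> (f n has_sum s n) S"
  shows "((\<lambda>i. \<Sum>n\<in>A. f n i) has_sum (\<Sum>n\<in>A. s n)) S"
  using assms by (induction A rule: finite_induct) (auto intro: has_sum_add has_sum_0)

text \<open>
  A bound for a partial sum of absolute values at each unit vector extends to all vectors, because
  the norm of \<open>\<ell>\<^sub>1\<close> is the largest one with given values at the unit vectors: any continuous seminorm
  at most \<open>B\<close> there is at most \<open>B\<close> times the norm. For a single functional (\<open>A\<close> a singleton) this is the
  estimate of its operator norm.
\<close>

lemma sum_norm_pairing_le:
  fixes x :: "('i, 'k::{real_normed_field, banach}) ell1"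
  assumes "finite A" and w: "\<And>i. (\<Sum>n\<in>A. \<bar>w n i\<bar>) \<le> B"
  shows "(\<Sum>n\<in>A. norm (pairing (w n) x)) \<le> B * norm x"
proof -
  have wB: "\<bar>w n i\<bar> \<le> B" if "n \<in> A" for n i
    using member_le_sum[OF that, of "\<lambda>n. \<bar>w n i\<bar>"] assms by (force intro: order_trans)
  have summ: "(\<lambda>i. \<bar>w n i\<bar> * norm (coord x i)) summable_on UNIV" if "n \<in> A" for n
    using abs_summable_pairing[of "w n", OF wB[OF that], of x] by (simp add: norm_mult)
  have "(\<Sum>n\<in>A. norm (pairing (w n) x)) \<le> (\<Sum>n\<in>A. \<Sum>\<^sub>\<infinity>i. \<bar>w n i\<bar> * norm (coord x i))"
  proof (rule sum_mono)
    fix n assume "n \<in> A"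
    from norm_infsum_bound[OF abs_summable_pairing[of "w n", OF wB[OF this], of x]]
    show "norm (pairing (w n) x) \<le> (\<Sum>\<^sub>\<infinity>i. \<bar>w n i\<bar> * norm (coord x i))"
      by (simp add: pairing_def norm_mult)
  qed
  also have "\<dots> = (\<Sum>\<^sub>\<infinity>i. \<Sum>n\<in>A. \<bar>w n i\<bar> * norm (coord x i))"
    by (rule infsumI[OF has_sum_sum[OF assms(1) has_sum_infsum[OF summ]], symmetric])
  also have "\<dots> \<le> (\<Sum>\<^sub>\<infinity>i. B * norm (coord x i))"
  proof (rule infsum_mono)
    show "(\<lambda>i. \<Sum>n\<in>A. \<bar>w n i\<bar> * norm (coord x i)) summable_on UNIV"
      by (rule has_sum_imp_summable[OF has_sum_sum[OF assms(1) has_sum_infsum[OF summ]]])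
    show "(\<lambda>i. B * norm (coord x i)) summable_on UNIV"
      by (intro summable_on_cmult_right abs_summable_coord)
    show "(\<Sum>n\<in>A. \<bar>w n i\<bar> * norm (coord x i)) \<le> B * norm (coord x i)" for i
      unfolding sum_distrib_right[symmetric] by (intro mult_right_mono w norm_ge_zero)
  qed
  also have "\<dots> = B * norm x"
    unfolding norm_ell1_def by (intro infsum_cmult_right abs_summable_coord)
  finally show ?thesis .
qed

lemma pairing_unit_vec [simp]: "pairing w (unit_vec i) = of_real (w i)"
proof -
  have "pairing w (unit_vec i) = (\<Sum>\<^sub>\<infinity>j\<in>{i}. of_real (w j))"
    unfolding pairing_def unit_vec.rep_eq by (rule infsum_cong_neutral) auto
  then show ?thesis by simp
qed

lemma pairing_in_dual:
  assumes w: "\<And>i. \<bar>w i\<bar> \<le> B"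
  shows "pairing w \<in> (ell1.dual :: (('i, 'k::{real_normed_field, banach}) ell1 \<Rightarrow> 'k) set)"
proof -
  note summ = abs_summable_summable[OF abs_summable_pairing[OF w]]
  have scale: "pairing w (scale_ell1 c x) = c * pairing w x" for c and x :: "('i, 'k) ell1"
    unfolding pairing_def scale_ell1.rep_eq
    by (simp add: mult.left_commute[of _ c] infsum_cmult_right summ)
  have "pairing w (x + y) = pairing w x + pairing w y" for x y :: "('i, 'k) ell1"
    unfolding pairing_def plus_ell1.rep_eq by (simp add: distrib_left infsum_add summ)
  moreover have "pairing w (r *\<^sub>R x) = r *\<^sub>R pairing w x" for r and x :: "('i, 'k) ell1"
    using scale[of "of_real r" x] by (simp add: ell1.scale_of_real scaleR_conv_of_real)
  moreover have "norm (pairing w x) \<le> norm x * B" for x :: "('i, 'k) ell1"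
    using sum_norm_pairing_le[of "{()}" "\<lambda>_. w" B x] w by (simp add: mult.commute)
  ultimately have "bounded_linear (pairing w :: ('i, 'k) ell1 \<Rightarrow> 'k)"
    by (rule bounded_linear_intro)
  then show ?thesis using scale by (simp add: ell1.dual_def)
qed

lemma pairing_in_dual_sphere:
  assumes w: "\<And>i. \<bar>w i\<bar> \<le> 1" and "w i = 1"
  shows "pairing w \<in> (ell1.dual_sphere :: (('i, 'k::{real_normed_field, banach}) ell1 \<Rightarrow> 'k) set)"
proof -
  let ?f = "pairing w :: ('i, 'k) ell1 \<Rightarrow> 'k"
  have dual: "?f \<in> ell1.dual" by (rule pairing_in_dual[OF w])
  have "norm (?f (unit_vec i)) \<le> onorm ?f * norm (unit_vec i :: ('i, 'k) ell1)"
    using dual by (intro onorm) (simp add: ell1.dual_def)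
  moreover have "onorm ?f \<le> 1"
    by (rule onorm_bound)
      (use sum_norm_pairing_le[of "{()}" "\<lambda>_. w" 1] w in simp_all)
  ultimately show ?thesis using dual assms(2) by (simp add: ell1.dual_sphere_def)
qed

section \<open>Square-root growth\<close>

text \<open>
  If \<open>|a\<^sub>n| \<ge> e\<close> for all \<open>n\<close> in \<open>A\<close>, then \<open>e |A| \<le> C \<surd>|A|\<close>, so \<open>|A| \<le> (C/e)\<^sup>2\<close>; only finitely
  many terms can thus be as large as \<open>e\<close>.
\<close>

lemma tendsto_zero_if_sum_le_sqrt:
  fixes a :: "nat \<Rightarrow> 'a::real_normed_vector"
  assumes a: "\<And>A. finite A \<Longrightarrow> (\<Sum>n\<in>A. norm (a n)) \<le> C * sqrt (card A)"
  shows "a \<longlonglongrightarrow> 0"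
proof (rule tendstoI)
  fix e :: real assume "e > 0"
  have "card A \<le> nat \<lceil>(C / e)\<^sup>2\<rceil>" if A: "A \<subseteq> {n. e \<le> norm (a n)}" "finite A" for A
  proof (cases "A = {}")
    case False
    then have pos: "sqrt (card A) > 0" using A(2) by (simp add: card_gt_0_iff)
    have "e * card A \<le> (\<Sum>n\<in>A. norm (a n))"
      using sum_bounded_below[of A e "\<lambda>n. norm (a n)"] A(1) by (auto simp: mult.commute)
    also have "\<dots> \<le> C * sqrt (card A)" by (rule a[OF A(2)])
    finally have "(e * sqrt (card A)) * sqrt (card A) \<le> C * sqrt (card A)"
      by (simp add: mult.assoc)
    then have "e * sqrt (card A) \<le> C" using pos by (rule mult_right_le_imp_le)
    then have "sqrt (card A) \<le> C / e" using \<open>e > 0\<close> by (simp add: field_simps)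
    then have "real (card A) \<le> (C / e)\<^sup>2"
      using pos power_mono[of "sqrt (card A)" "C / e" 2] by simp
    then show ?thesis by linarith
  qed simp
  then have "finite {n. e \<le> norm (a n)}"
    using finite_if_finite_subsets_card_bdd by blast
  then show "\<forall>\<^sub>F n in sequentially. dist (a n) 0 < e"
    by (simp add: cofinite_eq_sequentially[symmetric] eventually_cofinite not_less)
qed

text \<open>
  The element of \<open>R\<close> with \<open>k\<close> predecessors in \<open>R\<close> gets the weight \<open>1/\<surd>(k+1)\<close>. Finite sets
  \<open>R\<close> are included: the singletons make the functionals attain norm one.
\<close>

definition rank_weight :: "nat set \<Rightarrow> nat \<Rightarrow> real" where
  "rank_weight R n = (if n \<in> R then 1 / sqrt (1 + card (R \<inter> {..<n})) else 0)"

lemma rank_weight_bounds: "0 \<le> rank_weight R n" "rank_weight R n \<le> 1"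
  by (auto simp: rank_weight_def)

lemma rank_weight_singleton: "rank_weight {n} n = 1"
  by (simp add: rank_weight_def)

lemma rank_weight_range:
  fixes r :: "nat \<Rightarrow> nat"
  assumes "strict_mono r"
  shows "rank_weight (range r) (r n) = 1 / sqrt (1 + n)"
proof -
  have "range r \<inter> {..<r n} = r ` {..<n}"
    using strict_mono_less[OF assms] by auto
  then have "card (range r \<inter> {..<r n}) = n"
    by (simp add: card_image strict_mono_imp_inj_on[OF assms])
  then show ?thesis by (simp add: rank_weight_def)
qed

text \<open>
  The discrete form of \<open>\<surd>\<close> being concave with derivative \<open>1/(2\<surd>)\<close>; it makes
  \<open>1 + 1/\<surd>2 + \<dots> + 1/\<surd>m \<le> 2\<surd>m\<close> telescope.
\<close>

lemma inverse_sqrt_le_increment: "1 / sqrt (1 + real m) + 2 * sqrt m \<le> 2 * sqrt (1 + m)"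
proof -
  have "0 \<le> (sqrt (1 + real m) - sqrt m)\<^sup>2" by simp
  then have "1 + 2 * sqrt m * sqrt (1 + m) \<le> 2 * sqrt (1 + m) * sqrt (1 + m)"
    by (simp add: power2_diff algebra_simps)
  then show ?thesis by (simp add: field_simps)
qed

text \<open>
  Removing elements from \<open>R\<close> only raises the weights of those that remain, so the worst case is
  \<open>R = A\<close>, where the sum is \<open>1 + 1/\<surd>2 + \<dots> + 1/\<surd>|A|\<close>. The induction adds the elements of
  \<open>A\<close> in increasing order.
\<close>

lemma sum_rank_weight_le:
  assumes "finite A"
  shows "(\<Sum>n\<in>A. rank_weight R n) \<le> 2 * sqrt (card A)"
proof -
  \<comment> \<open>Counting only \<open>A \<inter> R\<close> is what makes the induction work: the rank of \<open>b\<close> in \<open>R\<close> is at least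
    the number of earlier elements of \<open>A \<inter> R\<close>, but need not reach the number of those of \<open>A\<close>.\<close>
  have "(\<Sum>n\<in>A. rank_weight R n) \<le> 2 * sqrt (card (A \<inter> R))"
    using assms
  proof (induction A rule: finite_linorder_max_induct)
    case (insert b A)
    show ?case
    proof (cases "b \<in> R")
      case True
      have "card (A \<inter> R) \<le> card (R \<inter> {..<b})"
        using insert.hyps by (intro card_mono) auto
      then have "rank_weight R b \<le> 1 / sqrt (1 + real (card (A \<inter> R)))"
        using True by (simp add: rank_weight_def frac_le)
      moreover have "card (insert b A \<inter> R) = 1 + card (A \<inter> R)"
        using True insert.hyps by (subst Int_insert_left_if1) auto
      moreover have "b \<notin> A" using insert.hyps by auto
      ultimately show ?thesis
        using insert.IH insert.hyps(1) inverse_sqrt_le_increment[of "card (A \<inter> R)"] by simp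
    next
      case False
      moreover have "b \<notin> A" using insert.hyps by auto
      ultimately show ?thesis using insert by (simp add: rank_weight_def)
    qed
  qed simp
  also have "\<dots> \<le> 2 * sqrt (card A)"
    using assms by (simp add: card_mono)
  finally show ?thesis .
qed

lemma sum_rank_weight_range_ge:
  fixes r :: "nat \<Rightarrow> nat" and N :: nat
  assumes "strict_mono r"
  shows "sqrt N \<le> (\<Sum>n<N. rank_weight (range r) (r n))"
proof (cases "N = 0")
  case False
  have "sqrt N = (\<Sum>n<N. 1 / sqrt N)"
    by (simp add: real_div_sqrt)
  also have "\<dots> \<le> (\<Sum>n<N. rank_weight (range r) (r n))"
    using False by (intro sum_mono) (simp add: rank_weight_range[OF assms] frac_le)
  finally show ?thesis .
qed simp

section \<open>From the continuum on\<close>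

text \<open>A surjection serves as the assignment of sets to coordinates; repetitions are harmless.\<close>

lemma surj_onto_nat_sets_if_continuum_le:
  assumes "ctwo ^c natLeq \<le>o |UNIV :: 'i set|"
  shows "\<exists>h :: 'i \<Rightarrow> nat set. surj h"
proof -
  have "|UNIV :: nat set set| =o |Func (UNIV :: nat set) (UNIV :: bool set)|"
    using card_of_Pow_Func[of "UNIV :: nat set"] by simp
  also have "|Func (UNIV :: nat set) (UNIV :: bool set)| = ctwo ^c natLeq"
    by (simp add: cexp_def ctwo_def Field_natLeq Field_card_of)
  finally have "|UNIV :: nat set set| \<le>o |UNIV :: 'i set|"
    using assms by (rule ordIso_ordLeq_trans)
  then show ?thesis
    using card_of_ordLeq2[of "UNIV :: nat set set" "UNIV :: 'i set"] by auto
qed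

text \<open>
  Dense subspaces of \<open>\<ell>\<^sub>1(\<kappa>)\<close> need not contain any unit vector, so divergence at the unit vector of
  \<open>range r\<close> is not enough. It has to persist under perturbations, and the square-root bound, which
  applies to the perturbation with its norm as a factor, ensures this.
\<close>

proposition not_property_P_from_continuum:
  assumes "ctwo ^c natLeq \<le>o |UNIV :: 'i set|"
  shows "\<not> property_P TYPE('i) TYPE('k::{real_normed_field, banach})"
proof
  assume P: "property_P TYPE('i) TYPE('k)"
  obtain h :: "'i \<Rightarrow> nat set" where h: "surj h"
    using surj_onto_nat_sets_if_continuum_le[OF assms] by blast
  define y :: "nat \<Rightarrow> ('i, 'k) ell1 \<Rightarrow> 'k" where
    "y n = pairing (\<lambda>i. rank_weight (h i) n)" for n
  have growth: "(\<Sum>n\<in>A. norm (y n x)) \<le> 2 * norm x * sqrt (card A)" if "finite A" for A x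
    using sum_norm_pairing_le[OF that, of "\<lambda>n i. rank_weight (h i) n" "2 * sqrt (card A)" x]
      sum_rank_weight_le[OF that]
    by (simp add: y_def rank_weight_bounds mult_ac)
  have sphere: "y n \<in> ell1.dual_sphere" for n
  proof -
    obtain i where "h i = {n}" using h by (metis surjD)
    then show ?thesis
      unfolding y_def
      by (intro pairing_in_dual_sphere[of _ i]) (simp_all add: rank_weight_bounds rank_weight_singleton)
  qed
  have "ell1.normal_seq y"
    unfolding ell1.normal_seq_iff using sphere tendsto_zero_if_sum_le_sqrt[OF growth] by blast
  then obtain r where r: "strict_mono r" "ell1.strongly_normal_seq (y \<circ> r)"
    using P unfolding property_P_def by blast
  obtain i where i: "h i = range r" using h by (metis surjD)
  have "unit_vec i \<in> closure {x. summable (\<lambda>n. norm (y (r n) x))}"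
    using r(2) by (simp add: ell1.strongly_normal_seq_def)
  then obtain x where x: "summable (\<lambda>n. norm (y (r n) x))" "dist x (unit_vec i) < 1/4"
    unfolding closure_approachable by (auto dest: spec[of _ "1/4 :: real"])
  \<comment> \<open>At the unit vector the partial sums are at least \<open>\<surd>N\<close>, and the error is at most
    \<open>2 * (1/4) * \<surd>N\<close>, so half of the growth is left.\<close>
  have "sqrt N \<le> 2 * (\<Sum>n. norm (y (r n) x))" for N :: nat
  proof -
    have diff: "y n (unit_vec i) = y n x - y n (x - unit_vec i)" for n
      using sphere[of n] by (simp add: ell1.dual_sphere_def ell1.dual_def linear_simps)
    have "sqrt N \<le> (\<Sum>n<N. norm (y (r n) (unit_vec i)))"
      using sum_rank_weight_range_ge[OF r(1), of N] by (simp add: y_def i rank_weight_bounds)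
    also have "\<dots> \<le> (\<Sum>n<N. norm (y (r n) x)) + (\<Sum>n<N. norm (y (r n) (x - unit_vec i)))"
      unfolding diff sum.distrib[symmetric] by (intro sum_mono norm_triangle_ineq4)
    also have "(\<Sum>n<N. norm (y (r n) (x - unit_vec i)))
        = (\<Sum>n\<in>r ` {..<N}. norm (y n (x - unit_vec i)))"
      by (simp add: sum.reindex strict_mono_imp_inj_on[OF r(1)])
    also have "\<dots> \<le> 2 * norm (x - unit_vec i) * sqrt (card (r ` {..<N}))"
      by (rule growth) simp
    also have "card (r ` {..<N}) = N"
      by (simp add: card_image strict_mono_imp_inj_on[OF r(1)])
    also have "2 * norm (x - unit_vec i) * sqrt N \<le> 1/2 * sqrt N"
      using x(2) by (intro mult_right_mono) (auto simp: dist_norm)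
    also have "(\<Sum>n<N. norm (y (r n) x)) \<le> (\<Sum>n. norm (y (r n) x))"
      by (rule sum_le_suminf[OF x(1)]) auto
    finally show ?thesis by simp
  qed
  moreover have "filterlim (\<lambda>N. sqrt (real N)) at_top sequentially"
    by (rule filterlim_compose[OF sqrt_at_top filterlim_real_sequentially])
  then have "\<exists>N. 2 * (\<Sum>n. norm (y (r n) x)) < sqrt (real N)"
    unfolding filterlim_at_top_dense eventually_sequentially by blast
  ultimately show False by (meson not_less)
qed

theorem theorem2:
  assumes "infinite (UNIV :: 'i set)"
  shows "( |UNIV :: 'i set| <o bounding_number \<longrightarrow>
             property_P TYPE('i) TYPE(real) \<and> property_P TYPE('i) TYPE(complex)) \<and>
         (ctwo ^c natLeq \<le>o |UNIV :: 'i set| \<longrightarrow>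
             \<not> property_P TYPE('i) TYPE(real) \<and> \<not> property_P TYPE('i) TYPE(complex))"
  using property_P_below_bounding_number[where 'i = 'i and 'k = real]
    property_P_below_bounding_number[where 'i = 'i and 'k = complex]
    not_property_P_from_continuum[where 'i = 'i and 'k = real]
    not_property_P_from_continuum[where 'i = 'i and 'k = complex]
  by blast

end
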